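(* Let $\alpha,\beta$ be non-negative integers, $k\ge1$, let $p_1,\ldots,p_k$ be distinct primes with $\gcd(p_i,6)=1$, let $\alpha_1,\ldots,\alpha_k$ be positive integers, and let $n=2^{\alpha}3^{\beta}\prod_{i=1}^{k}p_i^{\alpha_i}>12$. Let $R'=\{r_i: p_i\equiv r_i\pmod{12},\ 0\le r_i\le 11,\ 1\le i\le k\}$ be the set of residues of the $p_i$ modulo $12$. Then: (i) if $\alpha\in\{0,1\}$, $\beta=0$ and $R'=\{7,11\}$ or $\{7\}$: $\varphi_{12}(n)=\frac1{12}\varphi(n)+\frac14(-1)^{\Omega(n)}2^{\omega(n)-\alpha}$; (ii) if $\alpha\in\{0,1\}$, $\beta\ge2$ and $R'=\{7,11\}$, $\{7\}$ or $\{11\}$: $\varphi_{12}(n)=\frac1{12}\varphi(n)+\frac14(-1)^{\Omega(n)+1}2^{\omega(n)-\alpha}$; (iii) if either $\alpha\in\{0,1,2\}$, $\beta\in\{0,1\}$ and $R'=\{5,11\}$ or $\{5\}$; or $\alpha\in\{0,1\}$, $\beta=1$ and $R'=\{11\}$; or $\alpha=2$, $\beta\in\{0,1\}$ and $R'=\{11\}$: $\varphi_{12}(n)=\frac1{12}\varphi(n)+\frac16(-1)^{\Omega(n)+\lfloor(\alpha+1)/2\rfloor}2^{\omega(n)-\lfloor(\alpha+1)/2\rfloor-\beta}$; (iv) if $\alpha\ge3$, $\beta\in\{0,1\}$ and $R'=\{5,11\}$, $\{5\}$ or $\{11\}$: $\varphi_{12}(n)=\frac1{12}\varphi(n)+\frac16(-1)^{\Omega(n)}2^{\omega(n)-\beta}$;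 (v) if $\alpha=0$, $\beta=0$ and $R'=\{11\}$: $\varphi_{12}(n)=\frac1{12}\varphi(n)+\frac5{12}(-1)^{\Omega(n)}2^{\omega(n)}$; (vi) if $\alpha=1$, $\beta=0$ and $R'=\{11\}$: $\varphi_{12}(n)=\frac1{12}\varphi(n)+\frac1{12}(-1)^{\Omega(n)}2^{\omega(n)-1}$; (vii) in all other cases: $\varphi_{12}(n)=\frac1{12}\varphi(n)$.
   Context: For positive integers $n,e$, the generalized Euler function is $\varphi_e(n)=\#\{i\in\mathbb{Z}: 1\le i\le \lfloor n/e\rfloor,\ \gcd(i,n)=1\}$; $\varphi=\varphi_1$ is Euler's function. $\Omega(n)$ denotes the number of prime factors of $n$ counted with multiplicity and $\omega(n)$ the number of distinct prime factors of $n$. $\lfloor x\rfloor$ is the greatest integer not exceeding $x$. Conditions such as "$R'=\{7,11\}$" mean equality of sets. *)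

theory Defs
  imports "HOL-Number_Theory.Number_Theory"
begin

text \<open>
  The generalized Euler function. For positive \<open>e\<close>, the natural-number
  quotient \<open>n div e\<close> is the floor of \<open>n / e\<close>.
\<close>

definition gen_totient :: "nat \<Rightarrow> nat \<Rightarrow> nat" where
  "gen_totient e n = card {i. 1 \<le> i \<and> i \<le> n div e \<and> gcd i n = 1}"

lemma gen_totient_1: "gen_totient 1 n = totient n"
  unfolding gen_totient_def totient_def totatives_def
  by (rule arg_cong[where f = card]) (auto intro: iffD2[OF coprime_iff_gcd_eq_1])

definition big_omega :: "nat \<Rightarrow> nat" where
  "big_omega n = size (prime_factorization n)"

definition small_omega :: "nat \<Rightarrow> nat" where
  "small_omega n = card (prime_factors n)"

text \<open>
  The exceptional cases for \<open>n = 2 ^ \<alpha> * 3 ^ \<beta> * m\<close> with \<open>m\<close> coprime to 6, where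
  \<open>R\<close> is the set of residues modulo 12 of the prime divisors of \<open>m\<close>.
\<close>

definition case_i :: "nat \<Rightarrow> nat \<Rightarrow> nat set \<Rightarrow> bool" where
  "case_i \<alpha> \<beta> R \<longleftrightarrow> \<alpha> \<in> {0, 1} \<and> \<beta> = 0 \<and> (R = {7, 11} \<or> R = {7})"

definition case_ii :: "nat \<Rightarrow> nat \<Rightarrow> nat set \<Rightarrow> bool" where
  "case_ii \<alpha> \<beta> R \<longleftrightarrow> \<alpha> \<in> {0, 1} \<and> \<beta> \<ge> 2 \<and> (R = {7, 11} \<or> R = {7} \<or> R = {11})"

definition case_iii :: "nat \<Rightarrow> nat \<Rightarrow> nat set \<Rightarrow> bool" where
  "case_iii \<alpha> \<beta> R \<longleftrightarrow>
     (\<alpha> \<in> {0, 1, 2} \<and> \<beta> \<in> {0, 1} \<and> (R = {5, 11} \<or> R = {5})) \<or>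
     (\<alpha> \<in> {0, 1} \<and> \<beta> = 1 \<and> R = {11}) \<or>
     (\<alpha> = 2 \<and> \<beta> \<in> {0, 1} \<and> R = {11})"

definition case_iv :: "nat \<Rightarrow> nat \<Rightarrow> nat set \<Rightarrow> bool" where
  "case_iv \<alpha> \<beta> R \<longleftrightarrow> \<alpha> \<ge> 3 \<and> \<beta> \<in> {0, 1} \<and> (R = {5, 11} \<or> R = {5} \<or> R = {11})"

definition case_v :: "nat \<Rightarrow> nat \<Rightarrow> nat set \<Rightarrow> bool" where
  "case_v \<alpha> \<beta> R \<longleftrightarrow> \<alpha> = 0 \<and> \<beta> = 0 \<and> R = {11}"

definition case_vi :: "nat \<Rightarrow> nat \<Rightarrow> nat set \<Rightarrow> bool" where
  "case_vi \<alpha> \<beta> R \<longleftrightarrow> \<alpha> = 1 \<and> \<beta> = 0 \<and> R = {11}"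

end

theory Submission
  imports Defs
begin

text \<open>
  Inclusion--exclusion expresses \<open>gen_totient e n\<close> as the alternating sum of
  \<open>(n div d) div e\<close> over the squarefree divisors \<open>d\<close> of \<open>n\<close>. Comparing \<open>e = 12\<close> with
  \<open>e = 1\<close> shows that \<open>totient n - 12 * gen_totient 12 n\<close> is the alternating sum of
  \<open>(n div d) mod 12\<close>. On the residues coprime to 12, \<open>u \<mapsto> c * u mod 12\<close> is a constant plus
  an odd function, hence a combination of \<open>1\<close> and of the nontrivial characters modulo 4 and
  modulo 3. The alternating sum of a completely multiplicative \<open>f\<close> with values \<open>1\<close> and \<open>- 1\<close> is
  an Euler product, which vanishes as soon as \<open>f q = 1\<close> for some prime factor \<open>q\<close>.
\<close>

section \<open>Alternating sums over products of subsets\<close>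

text \<open>For a finite set \<open>P\<close> of primes this is the sum of mu(d) f(d) over the
  squarefree d built from \<open>P\<close>, with mu the Moebius function. Indexing by subsets allows
  induction on \<open>P\<close>.\<close>

definition altsum :: "nat set \<Rightarrow> (nat \<Rightarrow> int) \<Rightarrow> int" where
  "altsum P f = (\<Sum>T\<in>Pow P. (- 1) ^ card T * f (\<Prod>T))"

lemma altsum_empty [simp]: "altsum {} f = f 1"
  by (simp add: altsum_def)

text \<open>Subsets containing \<open>p\<close> arise from the others by inserting \<open>p\<close>,
  which flips the sign and multiplies the product by \<open>p\<close>.\<close>

lemma altsum_insert:
  assumes "finite P" "p \<notin> P"
  shows "altsum (insert p P) f = altsum P f - altsum P (\<lambda>d. f (p * d))"
proof -
  have inj: "inj_on (insert p) (Pow P)"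
    using assms(2) by (auto simp: inj_on_def)
  have "(\<Sum>T\<in>insert p ` Pow P. (- 1) ^ card T * f (\<Prod>T))
      = (\<Sum>T\<in>Pow P. (- 1) ^ card (insert p T) * f (\<Prod>(insert p T)))"
    by (simp add: sum.reindex[OF inj])
  also have "\<dots> = (\<Sum>T\<in>Pow P. - ((- 1) ^ card T * f (p * \<Prod>T)))"
  proof (intro sum.cong refl)
    fix T assume "T \<in> Pow P"
    then have "finite T" "p \<notin> T"
      using assms finite_subset by auto
    then show "(- 1) ^ card (insert p T) * f (\<Prod>(insert p T)) = - ((- 1) ^ card T * f (p * \<Prod>T))"
      by simp
  qed
  finally have eq: "(\<Sum>T\<in>insert p ` Pow P. (- 1) ^ card T * f (\<Prod>T))
      = - altsum P (\<lambda>d. f (p * d))"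
    by (simp add: altsum_def sum_negf)
  have "Pow P \<inter> insert p ` Pow P = {}"
    using assms(2) by auto
  then show ?thesis
    using assms(1) eq by (simp add: altsum_def Pow_insert sum.union_disjoint)
qed

lemma altsum_union:
  assumes "finite P" "finite Q" "P \<inter> Q = {}"
  shows "altsum (P \<union> Q) f = altsum P (\<lambda>d. altsum Q (\<lambda>e. f (d * e)))"
  using assms
proof (induction P arbitrary: f rule: finite_induct)
  case (insert p P)
  then show ?case
    by (simp add: altsum_insert mult.assoc)
qed simp

lemma altsum_add: "altsum P (\<lambda>d. f d + g d) = altsum P f + altsum P g"
  by (simp add: altsum_def sum.distrib algebra_simps)

lemma altsum_cmult: "altsum P (\<lambda>d. c * f d) = c * altsum P f"
  by (simp add: altsum_def sum_distrib_left mult_ac)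

lemma altsum_cong:
  "(\<And>T. T \<subseteq> P \<Longrightarrow> f (\<Prod>T) = g (\<Prod>T)) \<Longrightarrow> altsum P f = altsum P g"
  by (simp add: altsum_def)

text \<open>Inserting \<open>p\<close> multiplies the sum by \<open>1 - f p\<close>, which builds up
  a finite Euler product.\<close>

lemma altsum_multiplicative:
  assumes "finite P" "f 1 = 1" "\<And>x y. f (x * y) = f x * f y"
  shows "altsum P f = (\<Prod>p\<in>P. 1 - f p)"
  using assms(1)
  by (induction P rule: finite_induct)
     (simp_all add: altsum_insert altsum_cmult assms(2,3) algebra_simps flip: One_nat_def)

section \<open>Sieving for the generalized totient\<close>

text \<open>Legendre's sieve, one prime at a time: the numbers that survive \<open>P\<close> but are
  divisible by \<open>p\<close> are the \<open>p * j\<close> with \<open>j \<le> y div p\<close>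
  surviving \<open>P\<close>, since no prime in \<open>P\<close> divides \<open>p\<close>. Hence
  \<open>y\<close> must vary in the induction.\<close>

lemma card_not_divisible:
  assumes "finite P" "\<And>p. p \<in> P \<Longrightarrow> prime p"
  shows "int (card {i \<in> {1..y}. \<forall>p\<in>P. \<not> p dvd i}) = altsum P (\<lambda>d. int (y div d))"
  using assms
proof (induction P arbitrary: y rule: finite_induct)
  case (insert p P)
  let ?A = "\<lambda>P y. {i \<in> {1..y}. \<forall>p\<in>P. \<not> p dvd i}"
  have p: "prime p" "p > 0"
    using insert.prems prime_gt_0_nat by auto
  have image: "(*) p ` ?A P (y div p) = ?A P y \<inter> {i. p dvd i}"
  proof (intro equalityI subsetI)
    fix i assume "i \<in> (*) p ` ?A P (y div p)"
    then obtain j where j: "i = p * j" "j \<ge> 1" "j \<le> y div p" "\<forall>q\<in>P. \<not> q dvd j"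
      by auto
    have "\<not> q dvd p * j" if "q \<in> P" for q
      using that j(4) insert.hyps(2) insert.prems p(1)
      by (metis insertCI prime_dvd_mult_nat primes_dvd_imp_eq)
    moreover have "p * j \<le> y"
      using j(3) p(2) by (simp add: less_eq_div_iff_mult_less_eq mult.commute)
    ultimately show "i \<in> ?A P y \<inter> {i. p dvd i}"
      using j p(2) by auto
  next
    fix i assume i: "i \<in> ?A P y \<inter> {i. p dvd i}"
    then obtain j where j: "i = p * j"
      by auto
    have "j \<ge> 1" "j \<le> y div p"
      using i p(2) unfolding j by (auto simp: less_eq_div_iff_mult_less_eq mult.commute Suc_le_eq)
    moreover have "\<forall>q\<in>P. \<not> q dvd j"
      using i unfolding j by auto
    ultimately have "j \<in> ?A P (y div p)"
      by simp
    then show "i \<in> (*) p ` ?A P (y div p)"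
      using j by blast
  qed
  have "card (?A P y) = card (?A (insert p P) y \<union> (*) p ` ?A P (y div p))"
    unfolding image by (rule arg_cong[where f = card]) auto
  also have "\<dots> = card (?A (insert p P) y) + card ((*) p ` ?A P (y div p))"
    unfolding image by (rule card_Un_disjoint) auto
  also have "card ((*) p ` ?A P (y div p)) = card (?A P (y div p))"
    using p(2) by (intro card_image) (auto simp: inj_on_def)
  finally have "int (card (?A (insert p P) y)) = int (card (?A P y)) - int (card (?A P (y div p)))"
    by simp
  then show ?case
    using insert by (simp add: altsum_insert div_mult2_eq)
next
  case empty
  have "{i. Suc 0 \<le> i \<and> i \<le> y} = {1..y}"
    by auto
  then show ?case
    by simp
qed

text \<open>The sieve is applied at \<open>n div e\<close>. Both nested quotients equal division by
  \<open>e * d\<close>, so their order may be swapped.\<close>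

lemma gen_totient_altsum:
  assumes "n > 0"
  shows "int (gen_totient e n) = altsum (prime_factors n) (\<lambda>d. int (n div d div e))"
proof -
  have "gcd i n = 1 \<longleftrightarrow> (\<forall>p\<in>prime_factors n. \<not> p dvd i)" for i
  proof
    assume "gcd i n = 1"
    then show "\<forall>p\<in>prime_factors n. \<not> p dvd i"
      by (metis gcd_nat.boundedI in_prime_factors_iff not_prime_unit one_dvd)
  next
    assume *: "\<forall>p\<in>prime_factors n. \<not> p dvd i"
    show "gcd i n = 1"
    proof (rule ccontr)
      assume "gcd i n \<noteq> 1"
      then obtain p where "prime p" "p dvd gcd i n"
        using prime_factor_nat by blast
      then show False
        using * assms by (auto simp: in_prime_factors_iff)
    qed
  qed
  then have "gen_totient e n = card {i \<in> {1..n div e}. \<forall>p\<in>prime_factors n. \<not> p dvd i}"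
    unfolding gen_totient_def by (intro arg_cong[where f = card]) auto
  then have "int (gen_totient e n) = altsum (prime_factors n) (\<lambda>d. int (n div e div d))"
    by (simp only: card_not_divisible[OF finite_set_mset in_prime_factors_imp_prime])
  then show ?thesis
    by (simp add: div_mult2_eq[symmetric] mult.commute)
qed

text \<open>At \<open>e = 1\<close> the sieve sum is the totient. Splitting each
  \<open>n div d\<close> into quotient and remainder modulo \<open>e\<close> isolates the error as a
  sum of remainders.\<close>

lemma gen_totient_mod_altsum:
  assumes "n > 0"
  shows "int e * int (gen_totient e n)
    = int (totient n) - altsum (prime_factors n) (\<lambda>d. int (n div d mod e))"
proof -
  have "int (totient n) = altsum (prime_factors n) (\<lambda>d. int (n div d))"
    using gen_totient_altsum[OF assms, of 1] unfolding gen_totient_1 by simp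
  also have "\<dots> = altsum (prime_factors n) (\<lambda>d. int e * int (n div d div e) + int (n div d mod e))"
    by (simp flip: of_nat_mult of_nat_add)
  also have "\<dots> = int e * int (gen_totient e n) + altsum (prime_factors n) (\<lambda>d. int (n div d mod e))"
    by (simp add: altsum_add altsum_cmult gen_totient_altsum[OF assms])
  finally show ?thesis
    by simp
qed

section \<open>Euler products of multiplicative signs\<close>

lemma prod_subset_prime_factors_dvd:
  fixes n :: nat
  assumes "T \<subseteq> prime_factors n"
  shows "\<Prod>T dvd n"
proof (cases "n = 0")
  case False
  have "finite T"
    using assms finite_subset by auto
  have "\<Prod>T dvd \<Prod>(prime_factors n)"
    using assms by (intro prod_dvd_prod_subset) auto
  also have "\<dots> dvd (\<Prod>p\<in>prime_factors n. p ^ multiplicity p n)"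
    by (intro prod_dvd_prod dvd_power) (auto simp: prime_factors_multiplicity)
  also have "\<dots> = n"
    using False prime_factorization_nat by simp
  finally show ?thesis .
qed simp

lemma big_omega_mult: "x > 0 \<Longrightarrow> y > 0 \<Longrightarrow> big_omega (x * y) = big_omega x + big_omega y"
  by (simp add: big_omega_def prime_factorization_mult)

lemma big_omega_prime_power: "prime q \<Longrightarrow> big_omega (q ^ j) = j"
  by (simp add: big_omega_def prime_factorization_prime_power)

text \<open>Since \<open>f d = 1 / f d\<close>, the factor \<open>f (m div d)\<close> is \<open>f m * f d\<close>.\<close>

lemma altsum_sign:
  assumes m: "m > 0" and one: "f 1 = 1" and mult: "\<And>x y. f (x * y) = f x * f y"
    and sgn: "\<And>q. q \<in> prime_factors m \<Longrightarrow> f q = 1 \<or> f q = - 1"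
  shows "altsum (prime_factors m) (\<lambda>d. f (m div d)) =
    (if \<forall>q\<in>prime_factors m. f q = - 1 then (- 1) ^ big_omega m * 2 ^ card (prime_factors m) else 0)"
proof -
  let ?Q = "prime_factors m"
  have "f (m div \<Prod>T) = f m * f (\<Prod>T)" if T: "T \<subseteq> ?Q" for T
  proof -
    have "finite T"
      using T finite_subset by auto
    then have "f (\<Prod>T) = 1 \<or> f (\<Prod>T) = - 1"
      using T
    proof (induction T rule: finite_induct)
      case (insert q T)
      then show ?case
        using sgn[of q] by (auto simp: mult)
    qed (use one in simp)
    moreover have "f m = f (m div \<Prod>T) * f (\<Prod>T)"
      using prod_subset_prime_factors_dvd[OF T] by (metis mult dvd_div_mult_self)
    ultimately show ?thesis
      by auto
  qed
  then have "altsum ?Q (\<lambda>d. f (m div d)) = altsum ?Q (\<lambda>d. f m * f d)"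
    by (rule altsum_cong)
  also have "\<dots> = f m * (\<Prod>q\<in>?Q. 1 - f q)"
    by (simp only: altsum_cmult altsum_multiplicative[OF finite_set_mset one mult])
  also have "\<dots> = (if \<forall>q\<in>?Q. f q = - 1 then (- 1) ^ big_omega m * 2 ^ card ?Q else 0)"
  proof (cases "\<forall>q\<in>?Q. f q = - 1")
    case True
    \<comment> \<open>The sign of \<open>f m\<close> counts primes with multiplicity, whereas each
      distinct prime contributes \<open>1 - (- 1) = 2\<close> to the Euler product.\<close>
    have "f (prod_mset M) = (- 1) ^ size M" if "\<forall>q\<in>#M. f q = - 1" for M
      using that by (induction M) (simp_all add: mult one[unfolded One_nat_def])
    from this[of "prime_factorization m"] have "f m = (- 1) ^ big_omega m"
      using True m by (simp add: big_omega_def prod_mset_prime_factorization_nat)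
    then show ?thesis
      using True by simp
  next
    case False
    then have "(\<Prod>q\<in>?Q. 1 - f q) = 0"
      using sgn by (auto simp: prod_zero_iff)
    with False show ?thesis
      by (simp only: if_False mult_zero_right)
  qed
  finally show ?thesis .
qed

section \<open>Characters on the units modulo 12\<close>

definition chi4 :: "nat \<Rightarrow> int" where
  "chi4 x = (if x mod 4 = 1 then 1 else if x mod 4 = 3 then - 1 else 0)"

definition chi3 :: "nat \<Rightarrow> int" where
  "chi3 x = (if x mod 3 = 1 then 1 else if x mod 3 = 2 then - 1 else 0)"

lemma chi4_mult: "chi4 (x * y) = chi4 x * chi4 y"
proof -
  have "x mod 4 \<in> {0,1,2,3}" "y mod 4 \<in> {0,1,2,3}"
    by auto
  moreover have "x * y mod 4 = (x mod 4) * (y mod 4) mod 4"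
    by (simp add: mod_mult_eq)
  ultimately show ?thesis
    unfolding chi4_def by (elim insertE emptyE) simp_all
qed

lemma chi3_mult: "chi3 (x * y) = chi3 x * chi3 y"
proof -
  have "x mod 3 \<in> {0,1,2}" "y mod 3 \<in> {0,1,2}"
    by auto
  moreover have "x * y mod 3 = (x mod 3) * (y mod 3) mod 3"
    by (simp add: mod_mult_eq)
  ultimately show ?thesis
    unfolding chi3_def by (elim insertE emptyE) simp_all
qed

lemma coprime_6_mod_12:
  fixes x :: nat
  assumes "coprime x 6"
  shows "x mod 12 \<in> {1, 5, 7, 11}"
proof -
  have "\<not> 2 dvd x" "\<not> 3 dvd x"
    using assms by (auto dest!: coprime_common_divisor[of x 6])
  then have "\<not> 2 dvd x mod 12" "\<not> 3 dvd x mod 12"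
    by (simp_all add: dvd_mod_iff)
  moreover have "\<forall>r\<in>{0..<12::nat}. 2 dvd r \<or> 3 dvd r \<or> r \<in> {1, 5, 7, 11}"
    by code_simp
  ultimately show ?thesis
    by (meson atLeastLessThan_iff le0 mod_less_divisor zero_less_numeral)
qed

text \<open>This turns the survival condition of the Euler product, value -1 at every prime, into
  the residue sets of the theorem.\<close>

lemma chi4_residue:
  assumes "coprime x 6"
  shows "chi4 x = (if x mod 12 \<in> {7, 11} then - 1 else 1)"
proof -
  have "x mod 4 = x mod 12 mod 4"
    by (simp add: mod_mod_cancel)
  then show ?thesis
    using coprime_6_mod_12[OF assms] unfolding chi4_def by (elim insertE emptyE; simp)
qed

lemma chi3_residue:
  assumes "coprime x 6"
  shows "chi3 x = (if x mod 12 \<in> {5, 11} then - 1 else 1)"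
proof -
  have "x mod 3 = x mod 12 mod 3"
    by (simp add: mod_mod_cancel)
  then show ?thesis
    using coprime_6_mod_12[OF assms] unfolding chi3_def by (elim insertE emptyE; simp)
qed

text \<open>Twice the coefficients of \<open>chi4\<close> and \<open>chi3\<close> in the function \<open>u \<mapsto> c * u mod 12\<close>.\<close>

definition coeff4 :: "nat \<Rightarrow> int" where
  "coeff4 c = int (c mod 12) + int (5 * c mod 12) - (if c mod 12 = 0 then 0 else 12)"

definition coeff3 :: "nat \<Rightarrow> int" where
  "coeff3 c = int (c mod 12) - int (5 * c mod 12)"

text \<open>If 12 does not divide \<open>c\<close>, the residues of \<open>c * u\<close> and of its
  negative add up to 12, so subtracting 6 leaves an odd function of \<open>u\<close>. Odd functions
  on the four units are spanned by \<open>chi4\<close> and \<open>chi3\<close>; the values at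
  \<open>u = 1\<close> and \<open>u = 5\<close> determine the coefficients. Doubling keeps them
  integral.\<close>

lemma mult_mod_12_characters:
  assumes "coprime u 6"
  shows "2 * int (c * u mod 12) = (if c mod 12 = 0 then 0 else 12) + coeff4 c * chi4 u + coeff3 c * chi3 u"
proof -
  have mod: "c * u mod 12 = (c mod 12) * (u mod 12) mod 12" "5 * c mod 12 = 5 * (c mod 12) mod 12"
    by (rule mod_mult_eq[symmetric], rule mod_mult_right_eq[symmetric])
  have "\<forall>r\<in>{0..<12}. \<forall>v\<in>{1, 5, 7, 11}. 2 * int (r * v mod 12) = (if r = 0 then 0 else 12) +
      (int r + int (5 * r mod 12) - (if r = 0 then 0 else 12)) * (if v \<in> {7, 11} then - 1 else 1) +
      (int r - int (5 * r mod 12)) * (if v \<in> {5, 11} then - 1 else 1)"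
    by code_simp
  moreover have "c mod 12 \<in> {0..<12}"
    by simp
  ultimately show ?thesis
    using coprime_6_mod_12[OF assms]
    unfolding coeff4_def coeff3_def chi4_residue[OF assms] chi3_residue[OF assms] mod by blast
qed

section \<open>The contribution of the primes 2 and 3\<close>

lemma power_2_mod_12: "(2::nat) ^ Suc (Suc j) mod 12 = (if even j then 4 else 8)"
proof (induction j)
  case (Suc j)
  have "(2::nat) ^ Suc (Suc (Suc j)) mod 12 = 2 * (2 ^ Suc (Suc j) mod 12) mod 12"
    by (simp add: mod_mult_right_eq)
  then show ?case
    using Suc by (auto split: if_splits)
qed simp

lemma power_3_mod_12: "(3::nat) ^ Suc j mod 12 = (if even j then 3 else 9)"
proof (induction j)
  case (Suc j)
  have "(3::nat) ^ Suc (Suc j) mod 12 = 3 * (3 ^ Suc j mod 12) mod 12"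
    by (simp add: mod_mult_right_eq)
  then show ?case
    using Suc by (auto split: if_splits)
qed simp

lemma power_2_3_mod_12:
  "(2::nat) ^ i * 3 ^ j mod 12 =
    (if j = 0 then if i = 0 then 1 else if i = 1 then 2 else if even i then 4 else 8
     else if i = 0 then if even j then 9 else 3 else if i = 1 then 6 else 0)"
proof -
  \<comment> \<open>The alternation of 4 and 8 starts at exponent 2, hence the shift by 2 and the
    separate exponents 0 and 1.\<close>
  have 2: "(2::nat) ^ i mod 12 = (if i = 0 then 1 else if i = 1 then 2 else if even i then 4 else 8)"
    using power_2_mod_12[of "i - 2"] by (cases i; cases "i - 1") (simp_all del: power_Suc)
  have 3: "(3::nat) ^ j mod 12 = (if j = 0 then 1 else if even j then 9 else 3)"
    using power_3_mod_12[of "j - 1"] by (cases j) (simp_all del: power_Suc)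
  have "(2::nat) ^ i * 3 ^ j mod 12 = (2 ^ i mod 12) * (3 ^ j mod 12) mod 12"
    by (rule mod_mult_eq[symmetric])
  then show ?thesis
    unfolding 2 3 by simp
qed

text \<open>For even \<open>c\<close> the residue of \<open>c * u\<close> depends only on
  \<open>u\<close> modulo 6, hence for a unit only on \<open>u\<close> modulo 3, so
  \<open>chi4\<close> does not occur.\<close>

lemma coeff4_pow: "coeff4 (2 ^ i * 3 ^ j) =
  (if i = 0 then if j = 0 then - 6 else 6 * (- 1) ^ j else 0)"
  unfolding coeff4_def mod_mult_right_eq[of 5 "2 ^ i * 3 ^ j" 12, symmetric] power_2_3_mod_12
  by simp

text \<open>For \<open>c\<close> divisible by 3 the residue of \<open>c * u\<close> depends only on
  \<open>u\<close> modulo 4, so \<open>chi3\<close> does not occur.\<close>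

lemma coeff3_pow: "coeff3 (2 ^ i * 3 ^ j) =
  (if j = 0 then if i = 0 then - 4 else if i = 1 then - 8 else - 4 * (- 1) ^ i else 0)"
  unfolding coeff3_def mod_mult_right_eq[of 5 "2 ^ i * 3 ^ j" 12, symmetric] power_2_3_mod_12
  by simp

lemma prime_factors_2_3_pow:
  "prime_factors ((2::nat) ^ i * 3 ^ j) = (if i = 0 then {} else {2}) \<union> (if j = 0 then {} else {3})"
  by (auto simp: prime_factorization_mult prime_factors_power prime_prime_factors)

text \<open>Only the divisors 1, 2, 3 and 6 can occur, with signs +, -, -, +. The conditionals drop
  the absent ones, for which \<open>i - 1\<close> or \<open>j - 1\<close> would truncate.\<close>

lemma altsum_prime_factors_2_3_pow:
  "altsum (prime_factors (2 ^ i * 3 ^ j)) (\<lambda>d. f (2 ^ i * 3 ^ j div d)) =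
    f (2 ^ i * 3 ^ j) - (if i = 0 then 0 else f (2 ^ (i - 1) * 3 ^ j))
    - (if j = 0 then 0 else f (2 ^ i * 3 ^ (j - 1)))
    + (if i = 0 \<or> j = 0 then 0 else f (2 ^ (i - 1) * 3 ^ (j - 1)))"
proof -
  have div: "(2::nat) ^ Suc i * 3 ^ j div 2 = 2 ^ i * 3 ^ j"
      "(2::nat) ^ i * 3 ^ Suc j div 3 = 2 ^ i * 3 ^ j"
      "(2::nat) ^ Suc i * 3 ^ Suc j div 6 = 2 ^ i * 3 ^ j"
      "(2::nat) ^ Suc i div 2 = 2 ^ i" "(3::nat) ^ Suc j div 3 = 3 ^ j" for i j
    by simp_all
  show ?thesis
    unfolding prime_factors_2_3_pow
    by (cases i; cases j) (simp_all add: altsum_insert div del: power_Suc)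
qed

text \<open>Only terms without a factor 2 survive: none for \<open>i \<ge> 2\<close>, and those with
  sign flipped for \<open>i = 1\<close>. In \<open>j\<close>, the terms cancel at
  \<open>j = 1\<close> and reinforce each other from 6 to 12 beyond.\<close>

lemma altsum_coeff4:
  "altsum (prime_factors (2 ^ i * 3 ^ j)) (\<lambda>d. coeff4 (2 ^ i * 3 ^ j div d)) =
    (if i \<ge> 2 \<or> j = 1 then 0 else (- 1) ^ i * (if j = 0 then - 6 else 12 * (- 1) ^ j))"
  unfolding altsum_prime_factors_2_3_pow coeff4_pow
  by (cases i; cases "i - 1"; cases j; cases "j - 1") auto

text \<open>Only terms without a factor 3 survive. The irregular coefficient -8 at
  \<open>i = 1\<close> enters the differences at \<open>i = 1\<close> and \<open>i = 2\<close>,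
  giving -4 and 4; later differences of -4 and 4 double.\<close>

lemma altsum_coeff3:
  "altsum (prime_factors (2 ^ i * 3 ^ j)) (\<lambda>d. coeff3 (2 ^ i * 3 ^ j div d)) =
    (if j \<ge> 2 then 0 else
      (- 1) ^ j * (if i \<le> 1 then - 4 else if i = 2 then 4 else - 8 * (- 1) ^ i))"
  unfolding altsum_prime_factors_2_3_pow coeff3_pow
  by (cases i; cases "i - 1"; cases "i - 2"; cases j; cases "j - 1") auto

section \<open>Combining the two parts of n\<close>

text \<open>Squarefree divisors of \<open>n\<close> split as \<open>d * e\<close>, with
  \<open>d\<close> from the primes 2 and 3 and \<open>e\<close> from \<open>m\<close>. Coefficients
  depend only on \<open>d\<close> and characters only on \<open>e\<close>, so each double sum
  factors.\<close>

lemma totient_minus_gen_totient_12: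
  fixes i j m n :: nat
  assumes n_eq: "n = 2 ^ i * 3 ^ j * m" and m: "coprime m 6" "m > 1"
  shows "2 * (int (totient n) - 12 * int (gen_totient 12 n)) =
    altsum (prime_factors (2 ^ i * 3 ^ j)) (\<lambda>d. coeff4 (2 ^ i * 3 ^ j div d)) *
      (if \<forall>q\<in>prime_factors m. q mod 12 \<in> {7, 11}
       then (- 1) ^ big_omega m * 2 ^ card (prime_factors m) else 0) +
    altsum (prime_factors (2 ^ i * 3 ^ j)) (\<lambda>d. coeff3 (2 ^ i * 3 ^ j div d)) *
      (if \<forall>q\<in>prime_factors m. q mod 12 \<in> {5, 11}
       then (- 1) ^ big_omega m * 2 ^ card (prime_factors m) else 0)"
proof -
  define c where "c = (2::nat) ^ i * 3 ^ j"
  define s :: int where "s = (- 1) ^ big_omega m * 2 ^ card (prime_factors m)"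
  let ?P = "prime_factors c" and ?Q = "prime_factors m"
  have n: "n = c * m" "c > 0" "m > 0" "n > 0"
    using m by (auto simp: n_eq c_def)
  have coprime_factor: "coprime q 6" if "q \<in> ?Q" for q
    using that m(1) by (meson coprime_divisors dvd_refl in_prime_factors_imp_dvd)
  have Q: "?Q \<noteq> {}"
    using m(2) by (simp add: prime_factorization_empty_iff)
  have disjoint: "?P \<inter> ?Q = {}"
    using coprime_factor[of 2] coprime_factor[of 3] not_coprimeI[of 3 "3::nat" 6] unfolding c_def prime_factors_2_3_pow
    by (auto split: if_splits)
  \<comment> \<open>The constant 1 is multiplicative with value 1 at every prime, so its Euler
    product vanishes; \<open>m > 1\<close> supplies a prime. This removes the constant term of the
    expansion.\<close>
  have trivial: "altsum ?Q (\<lambda>e. k) = 0" for k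
    using altsum_sign[OF \<open>m > 0\<close>, of "\<lambda>_. 1"] altsum_cmult[of ?Q k "\<lambda>_. 1"] Q by auto
  have chi4: "altsum ?Q (\<lambda>e. chi4 (m div e)) = (if \<forall>q\<in>?Q. q mod 12 \<in> {7, 11} then s else 0)"
    unfolding s_def using coprime_factor
    by (subst altsum_sign[OF \<open>m > 0\<close> _ chi4_mult])
       (auto simp: chi4_residue chi4_def[of 1] split: if_splits)
  have chi3: "altsum ?Q (\<lambda>e. chi3 (m div e)) = (if \<forall>q\<in>?Q. q mod 12 \<in> {5, 11} then s else 0)"
    unfolding s_def using coprime_factor
    by (subst altsum_sign[OF \<open>m > 0\<close> _ chi3_mult])
       (auto simp: chi3_residue chi3_def[of 1] split: if_splits)
  have "2 * (int (totient n) - 12 * int (gen_totient 12 n))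
      = altsum (prime_factors n) (\<lambda>d. 2 * int (n div d mod 12))"
    using gen_totient_mod_altsum[OF \<open>n > 0\<close>, of 12] by (simp add: altsum_cmult)
  also have "prime_factors n = ?P \<union> ?Q"
    using n by (simp add: prime_factorization_mult)
  also have "altsum (?P \<union> ?Q) (\<lambda>d. 2 * int (n div d mod 12))
      = altsum ?P (\<lambda>d. altsum ?Q (\<lambda>e. 2 * int (n div (d * e) mod 12)))"
    using disjoint by (simp add: altsum_union)
  also have "\<dots> = altsum ?P (\<lambda>d. altsum ?Q (\<lambda>e. (if c div d mod 12 = 0 then 0 else 12) +
      coeff4 (c div d) * chi4 (m div e) + coeff3 (c div d) * chi3 (m div e)))"
  proof (intro altsum_cong)
    fix S T assume "S \<subseteq> ?P" "T \<subseteq> ?Q"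
    then have "\<Prod>S dvd c" and T: "\<Prod>T dvd m"
      by (simp_all add: prod_subset_prime_factors_dvd)
    then have "n div (\<Prod>S * \<Prod>T) = (c div \<Prod>S) * (m div \<Prod>T)"
      by (simp add: n div_mult_div_if_dvd)
    moreover have "coprime (m div \<Prod>T) 6"
      using m(1) T by (metis coprime_divisors dvd_div_mult_self dvd_refl dvd_triv_left)
    ultimately show "2 * int (n div (\<Prod>S * \<Prod>T) mod 12) = (if c div \<Prod>S mod 12 = 0 then 0 else 12) +
        coeff4 (c div \<Prod>S) * chi4 (m div \<Prod>T) + coeff3 (c div \<Prod>S) * chi3 (m div \<Prod>T)"
      using mult_mod_12_characters by simp
  qed
  also have "\<dots> = altsum ?P (\<lambda>d. coeff4 (c div d)) * altsum ?Q (\<lambda>e. chi4 (m div e))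
      + altsum ?P (\<lambda>d. coeff3 (c div d)) * altsum ?Q (\<lambda>e. chi3 (m div e))"
    by (simp add: altsum_add altsum_cmult trivial mult.commute[of _ "altsum ?Q f" for f])
  finally show ?thesis
    unfolding chi4 chi3 c_def s_def .
qed

section \<open>Reading off the case table\<close>

theorem theorem4p2:
  fixes \<alpha> \<beta> k n :: nat
    and p a :: "nat \<Rightarrow> nat"
    and R' :: "nat set"
  assumes k: "k \<ge> 1"
    and prime: "\<And>i. i \<in> {1..k} \<Longrightarrow> prime (p i)"
    and distinct: "inj_on p {1..k}"
    and coprime_6: "\<And>i. i \<in> {1..k} \<Longrightarrow> gcd (p i) 6 = 1"
    and exponents: "\<And>i. i \<in> {1..k} \<Longrightarrow> a i \<ge> 1"
    and n_eq: "n = 2 ^ \<alpha> * 3 ^ \<beta> * (\<Prod>i = 1..k. p i ^ a i)"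
    and n_gt: "n > 12"
    and R'_eq: "R' = {r. r \<le> 11 \<and> (\<exists>i\<in>{1..k}. [p i = r] (mod 12))}"
  shows
    "(case_i \<alpha> \<beta> R' \<longrightarrow>
        real (gen_totient 12 n) = 1 / 12 * real (totient n)
          + 1 / 4 * (- 1) ^ big_omega n * 2 powi (int (small_omega n) - int \<alpha>)) \<and>
     (case_ii \<alpha> \<beta> R' \<longrightarrow>
        real (gen_totient 12 n) = 1 / 12 * real (totient n)
          + 1 / 4 * (- 1) ^ (big_omega n + 1) * 2 powi (int (small_omega n) - int \<alpha>)) \<and>
     (case_iii \<alpha> \<beta> R' \<longrightarrow>
        real (gen_totient 12 n) = 1 / 12 * real (totient n)
          + 1 / 6 * (- 1) ^ (big_omega n + (\<alpha> + 1) div 2)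
              * 2 powi (int (small_omega n) - int ((\<alpha> + 1) div 2) - int \<beta>)) \<and>
     (case_iv \<alpha> \<beta> R' \<longrightarrow>
        real (gen_totient 12 n) = 1 / 12 * real (totient n)
          + 1 / 6 * (- 1) ^ big_omega n * 2 powi (int (small_omega n) - int \<beta>)) \<and>
     (case_v \<alpha> \<beta> R' \<longrightarrow>
        real (gen_totient 12 n) = 1 / 12 * real (totient n)
          + 5 / 12 * (- 1) ^ big_omega n * 2 ^ small_omega n) \<and>
     (case_vi \<alpha> \<beta> R' \<longrightarrow>
        real (gen_totient 12 n) = 1 / 12 * real (totient n)
          + 1 / 12 * (- 1) ^ big_omega n * 2 powi (int (small_omega n) - 1)) \<and>
     (\<not> case_i \<alpha> \<beta> R' \<and> \<not> case_ii \<alpha> \<beta> R' \<and> \<not> case_iii \<alpha> \<beta> R' \<and>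
      \<not> case_iv \<alpha> \<beta> R' \<and> \<not> case_v \<alpha> \<beta> R' \<and> \<not> case_vi \<alpha> \<beta> R' \<longrightarrow>
        real (gen_totient 12 n) = 1 / 12 * real (totient n))"
proof -
  define m where "m = (\<Prod>i = 1..k. p i ^ a i)"
  \<comment> \<open>\<open>x\<close> and \<open>y\<close> state that all primes of \<open>m\<close>
    have \<open>chi4\<close> value -1, respectively \<open>chi3\<close> value -1, so that the
    corresponding Euler product survives.\<close>
  define x where "x \<longleftrightarrow> R' \<subseteq> {7, 11}"
  define W w where "W = big_omega m" and "w = card (prime_factors m)"
  define y where "y \<longleftrightarrow> R' \<subseteq> {5, 11}"
  let ?Q = "prime_factors m"
  have "m > 0"
    unfolding m_def using prime by (auto intro!: prod_pos simp: prime_gt_0_nat)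
  have Q: "?Q = p ` {1..k}"
  proof -
    have "0 \<notin> (\<lambda>i. p i ^ a i) ` {1..k}"
      using prime prime_gt_0_nat by fastforce
    then have "?Q = (\<Union>i\<in>{1..k}. prime_factors (p i ^ a i))"
      unfolding m_def by (subst prime_factors_prod) auto
    also have "\<dots> = (\<Union>i\<in>{1..k}. {p i})"
    proof (intro SUP_cong refl)
      fix i assume "i \<in> {1..k}"
      then show "prime_factors (p i ^ a i) = {p i}"
        using prime[of i] exponents[of i] by (simp add: prime_factors_power prime_prime_factors)
    qed
    finally show ?thesis
      by auto
  qed
  then have "?Q \<noteq> {}"
    using k by auto
  then have "m > 1"
    using \<open>m > 0\<close> by (cases "m = 1") auto
  have coprime: "coprime m 6"
    unfolding m_def using coprime_6
    by (intro prod_coprime_left) (metis coprime_iff_gcd_eq_1 coprime_power_left_iff)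
  have n: "n = 2 ^ \<alpha> * 3 ^ \<beta> * m"
    using n_eq m_def by simp
  have R': "R' = (\<lambda>q. q mod 12) ` ?Q"
  proof (intro equalityI subsetI)
    fix r assume "r \<in> R'"
    then obtain i where "i \<in> {1..k}" "p i mod 12 = r mod 12" "r \<le> 11"
      unfolding R'_eq cong_def by blast
    then have "i \<in> {1..k}" "r = p i mod 12"
      by simp_all
    then show "r \<in> (\<lambda>q. q mod 12) ` ?Q"
      unfolding Q by blast
  next
    fix r assume "r \<in> (\<lambda>q. q mod 12) ` ?Q"
    then obtain i where i: "i \<in> {1..k}" "r = p i mod 12"
      unfolding Q by blast
    then have "r \<le> 11"
      using mod_less_divisor[of 12 "p i"] by linarith
    moreover have "[p i = r] (mod 12)"
      unfolding i(2) cong_def by (rule mod_mod_trivial[symmetric])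
    ultimately show "r \<in> R'"
      unfolding R'_eq using i(1) by blast
  qed
  then have R'_subset: "(\<forall>q\<in>?Q. q mod 12 \<in> S) \<longleftrightarrow> R' \<subseteq> S" for S
    by auto
  have "R' \<noteq> {}"
    using R' \<open>?Q \<noteq> {}\<close> by simp
  then have "R' \<subseteq> {c, d} \<longleftrightarrow> R' = {c} \<or> R' = {d} \<or> R' = {c, d}" for c d
    by blast
  then have R'_iff: "R' = {7, 11} \<or> R' = {7} \<longleftrightarrow> x \<and> \<not> y" "R' = {5, 11} \<or> R' = {5} \<longleftrightarrow> y \<and> \<not> x"
      "R' = {11} \<longleftrightarrow> x \<and> y"
    unfolding x_def y_def by (auto simp: doubleton_eq_iff)
  \<comment> \<open>In \<open>case_iii\<close> only the \<open>chi3\<close> term acts; the excluded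
    overlap, where \<open>chi4\<close> also contributes, is covered by \<open>case_v\<close> and
    \<open>case_vi\<close>.\<close>
  have cases:
    "case_i \<alpha> \<beta> R' \<longleftrightarrow> \<alpha> \<le> 1 \<and> \<beta> = 0 \<and> x \<and> \<not> y"
    "case_ii \<alpha> \<beta> R' \<longleftrightarrow> \<alpha> \<le> 1 \<and> \<beta> \<ge> 2 \<and> x"
    "case_iii \<alpha> \<beta> R' \<longleftrightarrow> \<alpha> \<le> 2 \<and> \<beta> \<le> 1 \<and> y \<and> \<not> (x \<and> \<alpha> \<le> 1 \<and> \<beta> = 0)"
    "case_iv \<alpha> \<beta> R' \<longleftrightarrow> \<alpha> \<ge> 3 \<and> \<beta> \<le> 1 \<and> y"
    "case_v \<alpha> \<beta> R' \<longleftrightarrow> \<alpha> = 0 \<and> \<beta> = 0 \<and> x \<and> y"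
    "case_vi \<alpha> \<beta> R' \<longleftrightarrow> \<alpha> = 1 \<and> \<beta> = 0 \<and> x \<and> y"
    unfolding case_i_def case_ii_def case_iii_def case_iv_def case_v_def case_vi_def
      disj_assoc[symmetric] R'_iff insert_iff empty_iff
    by auto
  have Omega: "big_omega n = \<alpha> + \<beta> + W"
    unfolding n using \<open>m > 0\<close> by (simp add: W_def big_omega_mult big_omega_prime_power)
  have "prime_factors n = prime_factors (2 ^ \<alpha> * 3 ^ \<beta>) \<union> ?Q"
    unfolding n using \<open>m > 0\<close> by (subst prime_factorization_mult) auto
  moreover have "2 \<notin> ?Q" "3 \<notin> ?Q"
    using coprime_6 by (force simp: Q)+
  ultimately have omega: "small_omega n = (if \<alpha> = 0 then 0 else 1) + (if \<beta> = 0 then 0 else 1) + w"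
    by (simp add: w_def small_omega_def prime_factors_2_3_pow)
  define s :: real where "s = (- 1) ^ W * 2 ^ w"
  \<comment> \<open>Both are nonzero only for \<open>\<alpha> \<le> 1\<close> and
    \<open>\<beta> = 0\<close>. If also \<open>x\<close> and \<open>y\<close> hold, -6 and -4 add up
    to give 5/12, while 6 and -4 partly cancel to give 1/12.\<close>
  define A B :: int
    where "A = (if \<alpha> \<ge> 2 \<or> \<beta> = 1 then 0 else (- 1) ^ \<alpha> * (if \<beta> = 0 then - 6 else 12 * (- 1) ^ \<beta>))"
      and "B = (if \<beta> \<ge> 2 then 0 else
        (- 1) ^ \<beta> * (if \<alpha> \<le> 1 then - 4 else if \<alpha> = 2 then 4 else - 8 * (- 1) ^ \<alpha>))"
  have "2 * (int (totient n) - 12 * int (gen_totient 12 n)) =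
      A * (if x then (- 1) ^ W * 2 ^ w else 0) +
      B * (if y then (- 1) ^ W * 2 ^ w else 0)"
    using totient_minus_gen_totient_12[OF n coprime \<open>m > 1\<close>]
    unfolding altsum_coeff4 altsum_coeff3 R'_subset n[symmetric] x_def[symmetric] y_def[symmetric]
      A_def B_def W_def w_def .
  then have "real_of_int (2 * (int (totient n) - 12 * int (gen_totient 12 n))) =
      of_int A * (if x then s else 0) + of_int B * (if y then s else 0)"
    by (simp add: s_def)
  \<comment> \<open>The 24 combines the modulus 12 with the doubling that cleared the
    halves.\<close>
  moreover define e :: real where "e = - (of_int A * (if x then s else 0) + of_int B * (if y then s else 0)) / 24"
  ultimately have g: "real (gen_totient 12 n) = 1 / 12 * real (totient n) + e"
    by simp
  have \<alpha>: "\<alpha> = 0 \<or> \<alpha> = 1 \<or> \<alpha> = 2 \<or> \<alpha> \<ge> 3" and \<beta>: "\<beta> = 0 \<or> \<beta> = 1 \<or> \<beta> \<ge> 2"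
    by auto
  \<comment> \<open>In \<open>case_ii\<close> and \<open>case_iv\<close> the exponent still counts
    one prime beyond those of \<open>m\<close>, namely 3 and 2 respectively.\<close>
  have "(2::real) powi (1 + int l) = 2 * 2 ^ l" for l
    by (simp add: power_int_add)
  with \<alpha> \<beta> show ?thesis
    unfolding cases g Omega omega add_left_cancel add_0_right add_cancel_left_right
    by (elim disjE; cases x; cases y) (simp_all add: e_def A_def B_def s_def power_add)
qed

end
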